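(* Let $\mathbf{X}$ be the random variable of $\mathcal{X}$. By linearising $F$ around the best-fitting orbit $\mathbf{x}^*$, the conditional probability density of $\mathbf{X}$ on $T_{\mathbf{x}^*}\mathcal{M}$ is given by $$p_{\mathbf{X}|T_{\mathbf{x}^*}\mathcal{M}}(\mathbf{x})=\frac{\exp\left(-\frac{\chi^2(\mathbf{x})}{2}\right)}{\int_{T_{\mathbf{x}^*}\mathcal{M}}\exp\left(-\frac{\chi^2(\mathbf{y})}{2}\right)d\mathbf{y}}.$$
   Context: Spaces. $A=\mathbb{S}^1\times(-\pi/2,\pi/2)\times\mathbb{R}^2$ is the attributable space (attributables $\mathcal{A}=(\alpha,\delta,\dot\alpha,\dot\delta)$: right ascension, declination and their time derivatives), $R=\mathbb{R}_{\ge 0}\times\mathbb{R}$ is the space of range/range-rate pairs $\boldsymbol\rho=(\rho,\dot\rho)$, and $\mathcal{X}=A\times R$ is the space of orbital elements $\mathbf{x}=(\mathcal{A},\boldsymbol\rho)$. The residuals space is $\mathbb{R}^m$ with $m\ge 6$, and $F:\mathcal{X}\to\mathbb{R}^m$ is the differentiable map giving the normalised observed-minus-computed astrometric residuals, $\boldsymbol\xi(\mathbf{x})=F(\mathbf{x})$. The target function is $Q(\mathbf{x})=\frac1m\boldsymbol\xi(\mathbf{x})^\top\boldsymbol\xi(\mathbf{x})$. Probability. The residuals are distributed according to a Gaussian random variable $\mathbf{\Xi}$ on $\mathbb{R}^m$ with density $p_{\mathbf{\Xi}}(\boldsymbol\xi)=(2\pi)^{-m/2}\exp(-\frac12\boldsymbol\xi^\top\boldsymbol\xi)$,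 and this density is propagated back to the orbital elements space through $F$. Manifold Of Variations. Let $K$ be a given subset of the Admissible Region (a compact subset of $R$ of admissible values of $\boldsymbol\rho$). For fixed $\boldsymbol\rho\in K$, the doubly constrained differential corrections are the differential corrections (a variant of Newton's method for minimising the target function) applied to the attributable $\mathcal{A}$ only, with $\boldsymbol\rho$ kept fixed; their normal equation is $B_{\mathcal{A}}^\top B_{\mathcal{A}}\,\Delta\mathcal{A}=-B_{\mathcal{A}}^\top\boldsymbol\xi$ with $B_{\mathcal{A}}=\partial\boldsymbol\xi/\partial\mathcal{A}$. $K'\subseteq K$ is the subset on which they converge, and for $\boldsymbol\rho\in K'$, $\mathcal{A}^*(\boldsymbol\rho)$ denotes the best-fit attributable obtained at convergence, a local minimum of $Q(\cdot,\boldsymbol\rho)$. The Manifold Of Variations is $\mathcal{M}=\{(\mathcal{A}^*(\boldsymbol\rho),\boldsymbol\rho):\boldsymbol\rho\in K'\}$, a 2-dimensional submanifold of $\mathcal{X}$. Best-fitting orbit and $\chi$. Put $Q^*=\min_{\boldsymbol\rho\in K'}Q(\mathcal{A}^*(\boldsymbol\rho),\boldsymbol\rho)$; the orbit $\mathbf{x}^*\in\mathcal{M}$ for which this minimum is attained is the best-fitting orbit. The $\chi$-value is $\chi(\mathbf{x})=\sqrt{m(Q(\mathbf{x})-Q^* )}$. $T_{\mathbf{x}^*}\mathcal{M}$ is the tangent plane to $\mathcal{M}$ at $\mathbf{x}^*$. Linearisation. Linearising $F$ around $\mathbf{x}^*$ means replacing $F(\mathbf{x})$ by $F(\mathbf{x}^*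 )+B(\mathbf{x}^* )(\mathbf{x}-\mathbf{x}^* )$, where $B=\partial F/\partial\mathbf{x}$ is the design matrix. The conditional density of $\mathbf{X}$ on $T_{\mathbf{x}^*}\mathcal{M}$ is the one obtained by propagating back, through this linearised map, the conditional density of $\mathbf{\Xi}$ on the affine subspace $\{F(\mathbf{x}^* )+B(\mathbf{x}^* )(\mathbf{x}-\mathbf{x}^* ):\mathbf{x}\in T_{\mathbf{x}^*}\mathcal{M}\}$ of $\mathbb{R}^m$. *)

theory Defs
  imports "HOL-Analysis.Analysis"
begin

text \<open>
  Orbital elements are written in the coordinates
  \<open>((\<alpha>, \<delta>, \<alpha>', \<delta>'), (\<rho>, \<rho>'))\<close>.  The circle is \<open>\<real> / 2\<pi>\<int>\<close>: the right ascension is a real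
  number, and two attributables related by \<open>turn\<close> are the same point.
  Maps on the space of orbital elements are maps invariant under \<open>turn\<close>, and its subsets are
  given by their full preimage.
\<close>

type_synonym attributable = "real \<times> real \<times> real \<times> real"
type_synonym range_pair = "real \<times> real"
type_synonym elements = "attributable \<times> range_pair"

definition attributable_space :: "attributable set" where
  "attributable_space = {(\<alpha>, \<delta>, \<alpha>', \<delta>'). - pi / 2 < \<delta> \<and> \<delta> < pi / 2}"

definition range_space :: "range_pair set" where
  "range_space = {(\<rho>, \<rho>'). 0 \<le> \<rho>}"

definition element_space :: "elements set" where
  "element_space = attributable_space \<times> range_space"

definition turn :: "int \<Rightarrow> attributable \<Rightarrow> attributable" where
  "turn k = (\<lambda>(\<alpha>, \<delta>, \<alpha>', \<delta>'). (\<alpha> + 2 * pi * of_int k, \<delta>, \<alpha>', \<delta>'))"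

definition residual_map :: "(elements \<Rightarrow> real ^ 'm) \<Rightarrow> bool" where
  "residual_map F \<longleftrightarrow>
     F differentiable_on element_space \<and>
     (\<forall>k. \<forall>(a, r)\<in>element_space. F (turn k a, r) = F (a, r))"

definition target :: "(elements \<Rightarrow> real ^ 'm) \<Rightarrow> elements \<Rightarrow> real" where
  "target F x = (F x \<bullet> F x) / real CARD('m)"

text \<open>
  The design matrix, as a linear map.  The derivative is taken within the space of orbital
  elements because of its boundary \<open>\<rho> = 0\<close>; it is unique there too.
\<close>

definition design :: "(elements \<Rightarrow> real ^ 'm) \<Rightarrow> elements \<Rightarrow> elements \<Rightarrow> real ^ 'm" where
  "design F x = frechet_derivative F (at x within element_space)"

definition design_attr ::
  "(elements \<Rightarrow> real ^ 'm) \<Rightarrow> range_pair \<Rightarrow> attributable \<Rightarrow> attributable \<Rightarrow> real ^ 'm" where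
  "design_attr F r a = frechet_derivative (\<lambda>a. F (a, r)) (at a)"

definition linearisation ::
  "(elements \<Rightarrow> real ^ 'm) \<Rightarrow> elements \<Rightarrow> elements \<Rightarrow> real ^ 'm" where
  "linearisation F x0 x = F x0 + design F x0 (x - x0)"


text \<open>
  Doubly constrained differential corrections, started at \<open>a0\<close> with \<open>r\<close> fixed.  Injectivity of
  the partial design matrix is invertibility of the normal matrix, so each correction is the
  unique solution of the normal equation.
\<close>

definition dc_converges_to ::
  "(elements \<Rightarrow> real ^ 'm) \<Rightarrow> range_pair \<Rightarrow> attributable \<Rightarrow> attributable \<Rightarrow> bool" where
  "dc_converges_to F r a0 l \<longleftrightarrow>
     l \<in> attributable_space \<and>
     (\<exists>a. a 0 = a0 \<and> a \<longlonglongrightarrow> l \<and>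
        (\<forall>n. a n \<in> attributable_space \<and>
             (let B = design_attr F r (a n) in
                inj B \<and> adjoint B (B (a (Suc n) - a n)) = - adjoint B (F (a n, r)))))"

definition manifold_of_variations ::
  "range_pair set \<Rightarrow> (range_pair \<Rightarrow> attributable) \<Rightarrow> elements set" where
  "manifold_of_variations K' best = {(turn k (best r), r) | k r. r \<in> K'}"

text \<open>The infimum is a minimum as soon as a best-fitting orbit exists.\<close>

definition target_min ::
  "(elements \<Rightarrow> real ^ 'm) \<Rightarrow> range_pair set \<Rightarrow> (range_pair \<Rightarrow> attributable) \<Rightarrow> real" where
  "target_min F K' best = (INF r\<in>K'. target F (best r, r))"

definition best_fitting_orbit ::
  "(elements \<Rightarrow> real ^ 'm) \<Rightarrow> range_pair set \<Rightarrow> (range_pair \<Rightarrow> attributable) \<Rightarrow> elements \<Rightarrow> bool"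
  where
  "best_fitting_orbit F K' best x \<longleftrightarrow>
     x \<in> manifold_of_variations K' best \<and> target F x = target_min F K' best"

definition chi_value :: "(elements \<Rightarrow> real ^ 'm) \<Rightarrow> real \<Rightarrow> elements \<Rightarrow> real" where
  "chi_value F Qmin x = sqrt (real CARD('m) * (target F x - Qmin))"


text \<open>Embedded surfaces of class \<open>C\<^sup>1\<close>, without boundary, given by local parametrisations.\<close>

definition C1_surface :: "'a::euclidean_space set \<Rightarrow> bool" where
  "C1_surface M \<longleftrightarrow>
     (\<forall>x\<in>M. \<exists>U W (\<phi> :: real ^ 2 \<Rightarrow> 'a) \<phi>' \<psi>.
        open U \<and> x \<in> U \<and> open W \<and> homeomorphism W (M \<inter> U) \<phi> \<psi> \<and>
        (\<forall>w\<in>W. (\<phi> has_derivative blinfun_apply (\<phi>' w)) (at w) \<and> inj (blinfun_apply (\<phi>' w))) \<and>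
        continuous_on W \<phi>')"

definition tangent_space :: "'a::real_normed_vector set \<Rightarrow> 'a \<Rightarrow> 'a set" where
  "tangent_space M x =
     {v. \<exists>\<gamma>. \<gamma> 0 = x \<and> (\<forall>\<^sub>F t in at (0::real). \<gamma> t \<in> M) \<and> (\<gamma> has_vector_derivative v) (at 0)}"

definition tangent_plane :: "'a::real_normed_vector set \<Rightarrow> 'a \<Rightarrow> 'a set" where
  "tangent_plane M x = (\<lambda>v. x + v) ` tangent_space M x"


text \<open>
  Area measure of an affine plane \<open>P\<close>, as a Borel measure on the whole space: the image of
  Lebesgue measure under an isometric parametrisation of \<open>P\<close>.  Any two of these differ by an
  isometry of \<open>\<real>\<^sup>2\<close>, so the choice does not matter.
\<close>

definition plane_lborel :: "'a::euclidean_space set \<Rightarrow> 'a measure" where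
  "plane_lborel P =
     distr lborel borel
       (SOME \<iota> :: real ^ 2 \<Rightarrow> 'a. (\<forall>u v. dist (\<iota> u) (\<iota> v) = dist u v) \<and> range \<iota> = P)"

definition gaussian_density :: "real ^ 'm \<Rightarrow> real" where
  "gaussian_density \<xi> = (2 * pi) powr (- real CARD('m) / 2) * exp (- (\<xi> \<bullet> \<xi>) / 2)"

text \<open>
  The conditional distribution on the plane \<open>P\<close> of a random variable with density \<open>p\<close>: its
  density with respect to area is \<open>p\<close> restricted to \<open>P\<close> and normalised.
\<close>

definition conditional_on_plane ::
  "('a::euclidean_space \<Rightarrow> real) \<Rightarrow> 'a set \<Rightarrow> 'a measure" where
  "conditional_on_plane p P =
     density (plane_lborel P) (\<lambda>\<xi>. ennreal (p \<xi> / (\<integral>\<eta>. p \<eta> \<partial>plane_lborel P)))"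

text \<open>
  Propagation of a distribution on \<open>G ` T\<close> back to \<open>T\<close>, for \<open>G\<close> injective on \<open>T\<close>.
\<close>

definition propagate_back ::
  "('a::topological_space \<Rightarrow> 'b) \<Rightarrow> 'a set \<Rightarrow> 'b measure \<Rightarrow> 'a measure" where
  "propagate_back G T N = distr N borel (the_inv_into T G)"

text \<open>The conditional distribution of the orbital elements on \<open>T\<close>, with residual map \<open>G\<close>.\<close>

definition conditional_elements ::
  "(elements \<Rightarrow> real ^ 'm) \<Rightarrow> elements set \<Rightarrow> elements measure" where
  "conditional_elements G T =
     propagate_back G T (conditional_on_plane gaussian_density (G ` T))"

end

theory Submission
  imports Defs
begin

text \<open>
  An injective affine map between planes multiplies area by a constant, and this constant
  disappears in the normalisation; so the conditional density on \<open>T\<close> is proportional to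
  \<open>exp (- \<parallel>L x\<parallel>\<^sup>2 / 2)\<close>.  Since \<open>Q\<close> restricted to the manifold is minimal at \<open>x\<^sup>*\<close>, the residual
  \<open>F x\<^sup>*\<close> is orthogonal to the image of the tangent space under the design matrix.  By Pythagoras
  \<open>\<parallel>L x\<parallel>\<^sup>2 = \<parallel>F x\<^sup>*\<parallel>\<^sup>2 + \<chi>\<^sup>2\<close> on \<open>T\<close>, and the constant factor from \<open>F x\<^sup>*\<close> cancels as well.
\<close>

section \<open>Isometries and affine changes of variables\<close>

text \<open>Polarisation turns preservation of distances into preservation of inner products for the
  map translated to fix the origin. The defects of additivity and homogeneity then have squared norm
  zero when expanded bilinearly.\<close>

lemma linear_isometry:
  fixes f :: "'a::real_inner \<Rightarrow> 'b::real_inner"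
  assumes "\<And>u v. dist (f u) (f v) = dist u v"
  shows "linear (\<lambda>u. f u - f 0)"
proof -
  define g where "g u = f u - f 0" for u
  have norm_g: "norm (g u - g v) = norm (u - v)" "norm (g u) = norm u" for u v
    using assms[of u v] assms[of u 0] by (simp_all add: g_def dist_norm)
  have inner_g: "g u \<bullet> g v = u \<bullet> v" for u v
    using norm_g by (simp add: dot_norm_neg)
  have "g (u + v) - g u - g v = 0" for u v
  proof -
    have "(g (u + v) - g u - g v) \<bullet> (g (u + v) - g u - g v) = 0"
      by (simp add: inner_diff_left inner_diff_right inner_g inner_add_left inner_add_right)
    then show ?thesis by simp
  qed
  moreover have "g (c *\<^sub>R u) - c *\<^sub>R g u = 0" for c u
  proof -
    have "(g (c *\<^sub>R u) - c *\<^sub>R g u) \<bullet> (g (c *\<^sub>R u) - c *\<^sub>R g u) = 0"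
      by (simp add: inner_diff_left inner_diff_right inner_g)
    then show ?thesis by simp
  qed
  ultimately have "linear g"
    by (intro linearI) (simp_all add: algebra_simps)
  then show ?thesis by (simp add: g_def[abs_def])
qed

text \<open>Boxes determine Lebesgue measure, and the preimage of a box is the image of a translated
  box under the inverse linear map, so its volume is scaled by a determinant. The result is an
  equation for \<open>lborel\<close> itself, so that it can be substituted in integrals and in
  densities alike.\<close>

lemma lborel_eq_density_distr_affine:
  fixes A :: "real ^ 'n::{finite,wellorder} \<Rightarrow> real ^ 'n::_"
  assumes "linear A" "inj A"
  obtains c where "c > 0" "lborel = density (distr lborel borel (\<lambda>u. b + A u)) (\<lambda>_. ennreal c)"
proof -
  obtain G where G: "linear G" "\<And>u. G (A u) = u" "\<And>u. A (G u) = u"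
    using linear_injective_isomorphism[OF assms] by blast
  have "inj G" using G(3) by (metis injI)
  then have d: "\<bar>det (matrix G)\<bar> > 0"
    using G(1) det_nz_iff_inj by auto
  have [measurable]: "(\<lambda>u. b + A u) \<in> borel_measurable borel"
    by (intro borel_measurable_continuous_onI continuous_intros
        linear_continuous_on linear_conv_bounded_linear[THEN iffD1] assms)
  have "lborel = density (distr lborel borel (\<lambda>u. b + A u)) (\<lambda>_. ennreal (1 / \<bar>det (matrix G)\<bar>))"
    (is "_ = ?N")
  proof (rule lborel_eqI)
    fix l u :: "real ^ 'n::_" assume lu: "\<And>i. i \<in> Basis \<Longrightarrow> l \<bullet> i \<le> u \<bullet> i"
    let ?X = "(\<lambda>u. b + A u) -` box l u"
    have X: "?X = G ` box (l - b) (u - b)"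
    proof -
      have "w \<in> ?X \<longleftrightarrow> A w \<in> box (l - b) (u - b)" for w
        by (auto simp: mem_box algebra_simps)
      moreover have "w \<in> G ` Y \<longleftrightarrow> A w \<in> Y" for w Y
        by (metis G(2,3) image_iff)
      ultimately show ?thesis by blast
    qed
    have m: "G ` box (l - b) (u - b) \<in> lmeasurable"
      by (rule measurable_linear_image[OF G(1) lmeasurable_box])
    \<comment> \<open>The volume formula for linear images concerns \<open>lebesgue\<close>; it
      transfers to \<open>lborel\<close> because the two measures agree on Borel sets.\<close>
    have "?X \<in> sets lborel"
      using measurable_sets_borel[of "\<lambda>u. b + A u" borel "box l u"] by simp
    then have "emeasure lborel ?X = emeasure lebesgue ?X" by simp
    also have "\<dots> = ennreal (measure lebesgue (G ` box (l - b) (u - b)))"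
      unfolding X by (rule emeasure_eq_measure2[OF m])
    also have "measure lebesgue (G ` box (l - b) (u - b)) =
        \<bar>det (matrix G)\<bar> * measure lebesgue (box (l - b) (u - b))"
      by (rule measure_linear_image[OF G(1) lmeasurable_box])
    also have "measure lebesgue (box (l - b) (u - b)) = (\<Prod>i\<in>Basis. (u - l) \<bullet> i)"
      using lu by (simp add: measure_lborel_box_eq algebra_simps)
    finally have "emeasure lborel ?X = ennreal (\<bar>det (matrix G)\<bar> * (\<Prod>i\<in>Basis. (u - l) \<bullet> i))" .
    then show "emeasure ?N (box l u) = ennreal (\<Prod>i\<in>Basis. (u - l) \<bullet> i)"
      using d by (simp add: emeasure_density_const emeasure_distr ennreal_mult'[symmetric])
  qed simp
  then show thesis using d by (intro that[of "1 / \<bar>det (matrix G)\<bar>"]) auto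
qed

section \<open>Area on affine planes and its transport\<close>

text \<open>Gives access to the parametrisation selected by \<open>SOME\<close> in
  \<open>plane_lborel\<close>. One exists: a linear isometry from the coordinate plane onto
  \<open>S\<close>, followed by translation by \<open>x\<close>.\<close>

lemma plane_lborel_isometry:
  fixes S :: "'a::euclidean_space set"
  assumes "subspace S" "dim S = 2"
  obtains \<iota> :: "real ^ 2 \<Rightarrow> 'a" where "\<And>u v. dist (\<iota> u) (\<iota> v) = dist u v"
    "range \<iota> = (+) x ` S" "plane_lborel ((+) x ` S) = distr lborel borel \<iota>"
    "\<iota> \<in> borel_measurable borel"
proof -
  let ?P = "\<lambda>\<iota> :: real ^ 2 \<Rightarrow> 'a. (\<forall>u v. dist (\<iota> u) (\<iota> v) = dist u v) \<and> range \<iota> = (+) x ` S"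
  obtain f :: "real ^ 2 \<Rightarrow> 'a" where f: "linear f" "f ` UNIV = S" "\<And>u. norm (f u) = norm u"
  proof -
    have "dim (UNIV :: (real ^ 2) set) = dim S" using assms(2) by simp
    then show thesis
      using isometry_subspaces[OF subspace_UNIV assms(1)] that by (metis UNIV_I)
  qed
  have "?P (\<lambda>u. x + f u)"
    using f by (auto simp: dist_norm linear_diff[symmetric])
  then have "?P (SOME \<iota>. ?P \<iota>)" by (rule someI[of ?P])
  moreover have "\<iota> \<in> borel_measurable borel" if "?P \<iota>" for \<iota>
    using that by (intro borel_measurable_continuous_onI) (auto simp: continuous_on_iff)
  ultimately show thesis by (intro that) (auto simp: plane_lborel_def)
qed

text \<open>The area measure lives on the whole space; this allows identities valid only on the
  plane to be used under it.\<close>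

lemma AE_plane_lborel:
  fixes S :: "'a::euclidean_space set"
  assumes "subspace S" "dim S = 2"
  shows "AE y in plane_lborel ((+) x ` S). y \<in> (+) x ` S"
proof -
  obtain \<iota> :: "real ^ 2 \<Rightarrow> 'a" where \<iota>: "range \<iota> = (+) x ` S"
    "plane_lborel ((+) x ` S) = distr lborel borel \<iota>" and [measurable]: "\<iota> \<in> borel_measurable borel"
    using plane_lborel_isometry[OF assms, of x] by metis
  have [measurable]: "(+) x ` S \<in> sets borel"
    using assms(1) by (intro borel_closed closed_translation closed_subspace)
  have "\<iota> u \<in> (+) x ` S" for u using \<iota>(1) by blast
  then show ?thesis
    unfolding \<iota>(2) by (subst AE_distr_iff) auto
qed

lemma propagate_back_affine:
  fixes L B :: "'a::euclidean_space \<Rightarrow> 'b::euclidean_space"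
  assumes "linear B" and L: "\<And>x. L x = c + B x"
    and "subspace S" "dim S = 2" and T: "T = (+) x ` S" and "inj_on L T"
    and [measurable]: "p \<in> borel_measurable borel"
  shows "propagate_back L T (conditional_on_plane p (L ` T)) =
    density (plane_lborel T) (\<lambda>x. ennreal (p (L x) / (\<integral>y. p (L y) \<partial>plane_lborel T)))"
proof -
  have inj_B: "inj_on B S"
    using \<open>inj_on L T\<close> by (auto simp: inj_on_def T L linear_add[OF \<open>linear B\<close>])
  have LT: "L ` T = (+) (L x) ` (B ` S)"
    by (auto simp: T L image_image linear_add[OF \<open>linear B\<close>] algebra_simps)
  have S': "subspace (B ` S)" "dim (B ` S) = 2"
    using linear_subspace_image[OF \<open>linear B\<close> \<open>subspace S\<close>] dim_image_eq[OF \<open>linear B\<close>, of S]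
      span_eq_iff[THEN iffD2, OF \<open>subspace S\<close>] \<open>dim S = 2\<close> inj_B
    by simp_all
  obtain \<iota> :: "real ^ 2 \<Rightarrow> 'a" where \<iota>: "\<And>u v. dist (\<iota> u) (\<iota> v) = dist u v" "range \<iota> = T"
    "plane_lborel T = distr lborel borel \<iota>" and [measurable]: "\<iota> \<in> borel_measurable borel"
    using plane_lborel_isometry[OF \<open>subspace S\<close> \<open>dim S = 2\<close>, of x] unfolding T by metis
  obtain \<kappa> :: "real ^ 2 \<Rightarrow> 'b" where \<kappa>: "\<And>u v. dist (\<kappa> u) (\<kappa> v) = dist u v" "range \<kappa> = L ` T"
    "plane_lborel (L ` T) = distr lborel borel \<kappa>" and [measurable]: "\<kappa> \<in> borel_measurable borel"
    using plane_lborel_isometry[OF S', of "L x"] unfolding LT by metis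
  have "continuous_on UNIV L"
    unfolding L by (intro continuous_intros linear_continuous_on
        linear_conv_bounded_linear[THEN iffD1] \<open>linear B\<close>)
  then have [measurable]: "L \<in> borel_measurable borel"
    by (rule borel_measurable_continuous_onI)

  define h where "h u = inv \<kappa> (L (\<iota> u))" for u
  have h: "\<kappa> (h u) = L (\<iota> u)" for u
    unfolding h_def using \<iota>(2) \<kappa>(2) by (intro f_inv_into_f) auto
  have inj_\<kappa>: "u = v" if "\<kappa> u = \<kappa> v" for u v
    using \<kappa>(1)[of u v] that by simp
  \<comment> \<open>\<open>h\<close> is defined through an inverse, so its linear part
    \<open>A\<close> is not visibly linear. It inherits linearity from
    \<open>H (A u) = B (J u)\<close>, since the linear part \<open>H\<close> of
    \<open>\<kappa>\<close> is injective.\<close>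
  define A where "A u = h u - h 0" for u
  define J where "J = (\<lambda>u. \<iota> u - \<iota> 0)"
  define H where "H = (\<lambda>u. \<kappa> u - \<kappa> 0)"
  have lin: "linear J" "linear H"
    unfolding J_def H_def using \<iota>(1) \<kappa>(1) by (auto intro: linear_isometry)
  have HA: "H (A u) = B (J u)" for u
  proof -
    have "H (A u) = H (h u) - H (h 0)"
      unfolding A_def by (rule linear_diff[OF lin(2)])
    also have "\<dots> = B (J u)"
      by (simp add: H_def J_def h L linear_diff[OF \<open>linear B\<close>])
    finally show ?thesis .
  qed
  have inj_H: "u = v" if "H u = H v" for u v
    using that inj_\<kappa> by (simp add: H_def)
  have "linear A"
  proof (rule linearI)
    show "A (u + v) = A u + A v" for u v
      by (rule inj_H) (simp add: HA linear_add[OF lin(1)] linear_add[OF lin(2)] linear_add[OF \<open>linear B\<close>])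
    show "A (r *\<^sub>R u) = r *\<^sub>R A u" for r u
      by (rule inj_H) (simp add: HA linear_scale[OF lin(1)] linear_scale[OF lin(2)] linear_scale[OF \<open>linear B\<close>])
  qed
  moreover have "inj A"
  proof (rule injI)
    fix u v assume "A u = A v"
    then have "\<kappa> (h u) = \<kappa> (h v)" by (simp add: A_def)
    then have "\<iota> u = \<iota> v"
      using inj_onD[OF \<open>inj_on L T\<close>, of "\<iota> u" "\<iota> v"] \<iota>(2) by (auto simp: h)
    then show "u = v" using \<iota>(1)[of u v] by simp
  qed
  ultimately obtain k where "k > 0"
    "lborel = density (distr lborel borel (\<lambda>u. h 0 + A u)) (\<lambda>_. ennreal k)"
    using lborel_eq_density_distr_affine by blast
  then have k: "k > 0" "lborel = density (distr lborel borel h) (\<lambda>_. ennreal k)"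
    by (simp_all add: A_def)
  have "continuous_on UNIV (\<lambda>u. h 0 + A u)"
    by (intro continuous_intros linear_continuous_on
        linear_conv_bounded_linear[THEN iffD1] \<open>linear A\<close>)
  then have [measurable]: "h \<in> borel_measurable borel"
    by (simp add: A_def borel_measurable_continuous_onI)

  let ?g = "the_inv_into T L"
  obtain G where G: "linear G" "\<And>v. v \<in> S \<Longrightarrow> G (B v) = v"
    using linear_exists_left_inverse_on[OF \<open>linear B\<close> \<open>subspace S\<close> inj_B] by auto
  \<comment> \<open>Measurability on the whole space requires the values off \<open>L\<close>
    T\<open>as well. There the description has no solution, so the inverse takes the fixed
    value\<close>THE x. False\<open>; on the closed plane\<close>L \<open>T\<close> it is affine,
    hence continuous.\<close>
  have g: "?g = (\<lambda>y. if y \<in> L ` T then x + G (y - L x) else (THE x. False))"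
  proof
    fix y
    show "?g y = (if y \<in> L ` T then x + G (y - L x) else (THE x. False))"
    proof (cases "y \<in> L ` T")
      case True
      then obtain v where v: "v \<in> S" "y = L (x + v)" by (auto simp: T)
      then have "?g y = x + v"
        using \<open>inj_on L T\<close> by (auto simp: T intro: the_inv_into_f_f)
      also have "v = G (y - L x)"
        using v by (simp add: L linear_add[OF \<open>linear B\<close>] G(2))
      finally show ?thesis using True by simp
    next
      case False
      then have "(\<lambda>z. z \<in> T \<and> L z = y) = (\<lambda>z. False)" by auto
      then show ?thesis using False by (simp add: the_inv_into_def)
    qed
  qed
  have [measurable]: "?g \<in> borel_measurable borel"
    unfolding g
  proof (rule borel_measurable_continuous_on_if)
    show "L ` T \<in> sets borel"
      unfolding LT using S'(1) by (intro borel_closed closed_translation closed_subspace)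
    show "continuous_on (L ` T) (\<lambda>y. x + G (y - L x))"
      by (intro continuous_intros linear_continuous_on_compose[OF _ G(1)])
  qed simp
  have g_h: "?g (\<kappa> (h u)) = \<iota> u" for u
    using \<open>inj_on L T\<close> \<iota>(2) by (auto simp: h intro: the_inv_into_f_f)

  define I where "I = (\<integral>y. p (L y) \<partial>plane_lborel T)"
  have "(\<integral>y. p y \<partial>plane_lborel (L ` T)) = (\<integral>u. p (\<kappa> u) \<partial>lborel)"
    by (simp add: \<kappa>(3) integral_distr)
  also have "\<dots> = (\<integral>u. k *\<^sub>R p (\<kappa> u) \<partial>distr lborel borel h)"
    by (subst k(2), rule integral_density) (use k(1) in auto)
  also have "\<dots> = k * (\<integral>u. p (L (\<iota> u)) \<partial>lborel)"
    by (simp add: integral_distr h)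
  also have "\<dots> = k * I"
    by (simp add: I_def \<iota>(3) integral_distr)
  finally have I': "(\<integral>y. p y \<partial>plane_lborel (L ` T)) = k * I" .

  define q where "q y = ennreal (p y / (k * I))" for y
  have [measurable]: "q \<in> borel_measurable borel" by (simp add: q_def[abs_def])
  have "propagate_back L T (conditional_on_plane p (L ` T)) =
      distr (density (distr lborel borel \<kappa>) q) borel ?g"
    unfolding propagate_back_def conditional_on_plane_def I' q_def[abs_def] \<kappa>(3)[symmetric] ..
  also have "\<dots> = distr (density lborel (\<lambda>u. q (\<kappa> u))) borel (?g \<circ> \<kappa>)"
    by (simp add: density_distr distr_distr)
  \<comment> \<open>Writing \<open>lborel\<close> as a multiple of its image under \<open>h\<close>
    makes \<open>\<kappa>\<close> occur only as \<open>\<kappa> (h u)\<close>, which is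
    \<open>L (\<iota> u)\<close>; the back-propagated point is then
    \<open>\<iota> u\<close>.\<close>
  also have "density lborel (\<lambda>u. q (\<kappa> u)) =
      density (density (distr lborel borel h) (\<lambda>_. ennreal k)) (\<lambda>u. q (\<kappa> u))"
    by (simp flip: k(2))
  also have "\<dots> = density (distr lborel borel h) (\<lambda>u. ennreal k * q (\<kappa> u))"
    by (simp add: density_density_eq)
  also have "\<dots> = distr (density lborel (\<lambda>u. ennreal k * q (L (\<iota> u)))) borel h"
    by (simp add: density_distr h)
  also have "distr \<dots> borel (?g \<circ> \<kappa>) = distr (density lborel (\<lambda>u. ennreal k * q (L (\<iota> u)))) borel \<iota>"
    by (simp add: distr_distr comp_def g_h)
  also have "\<dots> = density (plane_lborel T) (\<lambda>x. ennreal k * q (L x))"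
    by (simp add: \<iota>(3) density_distr)
  \<comment> \<open>This covers \<open>I = 0\<close> too: division by zero makes both sides
    zero.\<close>
  also have "(\<lambda>x. ennreal k * q (L x)) = (\<lambda>x. ennreal (p (L x) / I))"
    using k(1) by (simp add: q_def ennreal_mult'[symmetric])
  finally show ?thesis by (simp add: I_def)
qed

section \<open>Tangent spaces and first-order optimality\<close>

text \<open>
  Along a curve \<open>\<gamma>\<close> in the surface, the parameters \<open>w t\<close> of \<open>\<gamma> t\<close> satisfy \<open>w t - w0 = O (\<gamma> t - x)\<close>
  because the derivative \<open>D\<close> of the parametrisation is bounded below.  Hence the difference
  quotients of \<open>\<gamma>\<close> approach the closed subspace \<open>range D\<close>.
\<close>

lemma tangent_space_C1_surface:
  fixes M :: "'a::euclidean_space set"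
  assumes "C1_surface M" "x \<in> M"
  obtains D :: "real ^ 2 \<Rightarrow> 'a" where "linear D" "inj D" "tangent_space M x = range D"
proof -
  obtain U W and \<phi> :: "real ^ 2 \<Rightarrow> 'a" and \<phi>' \<psi> where
    U: "open U" "x \<in> U" and "open W" and hom: "homeomorphism W (M \<inter> U) \<phi> \<psi>"
    and der: "\<And>w. w \<in> W \<Longrightarrow> (\<phi> has_derivative blinfun_apply (\<phi>' w)) (at w)"
    and inj: "\<And>w. w \<in> W \<Longrightarrow> inj (blinfun_apply (\<phi>' w))"
    using assms unfolding C1_surface_def by metis
  define w0 where "w0 = \<psi> x"
  define D where "D = blinfun_apply (\<phi>' w0)"
  have w0: "w0 \<in> W" "\<phi> w0 = x"
    using homeomorphism_image2[OF hom] homeomorphism_apply2[OF hom, of x] U(2) \<open>x \<in> M\<close>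
    by (auto simp: w0_def)
  have D: "linear D" "inj D" "(\<phi> has_derivative D) (at w0)"
    using der[OF w0(1)] inj[OF w0(1)] has_derivative_linear by (auto simp: D_def)
  have "range D \<subseteq> tangent_space M x"
  proof
    fix v assume "v \<in> range D"
    then obtain u where u: "v = D u" by auto
    \<comment> \<open>Lines through \<open>w0\<close> in the parameter domain realise every vector
      of \<open>range D\<close> as a velocity.\<close>
    define \<gamma> where "\<gamma> t = \<phi> (w0 + t *\<^sub>R u)" for t :: real
    have "((\<lambda>t. w0 + t *\<^sub>R u) \<longlongrightarrow> w0 + 0 *\<^sub>R u) (at 0)"
      by (intro tendsto_intros)
    then have "\<forall>\<^sub>F t in at 0. w0 + t *\<^sub>R u \<in> W"
      using topological_tendstoD[OF _ \<open>open W\<close>] w0 by simp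
    then have "\<forall>\<^sub>F t in at 0. \<gamma> t \<in> M"
      by eventually_elim (use homeomorphism_image1[OF hom] in \<open>auto simp: \<gamma>_def\<close>)
    moreover have "((\<lambda>t. w0 + t *\<^sub>R u) has_derivative (\<lambda>t. t *\<^sub>R u)) (at 0)"
      by (auto intro!: derivative_eq_intros)
    then have "(\<gamma> has_derivative (\<lambda>t. D (t *\<^sub>R u))) (at 0)"
      using has_derivative_compose[of "\<lambda>t. w0 + t *\<^sub>R u" _ 0 UNIV \<phi> D] D(3)
      unfolding \<gamma>_def by simp
    then have "(\<gamma> has_vector_derivative v) (at 0)"
      by (simp add: has_vector_derivative_def u linear_scale[OF D(1)])
    ultimately show "v \<in> tangent_space M x"
      unfolding tangent_space_def using w0(2) by (auto simp: \<gamma>_def intro!: exI[of _ \<gamma>])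
  qed
  moreover have "tangent_space M x \<subseteq> range D"
  proof
    fix v assume "v \<in> tangent_space M x"
    then obtain \<gamma> where \<gamma>: "\<gamma> 0 = x" "\<forall>\<^sub>F t in at (0::real). \<gamma> t \<in> M"
      "(\<gamma> has_vector_derivative v) (at 0)"
      unfolding tangent_space_def by auto
    have "(\<gamma> \<longlongrightarrow> x) (at 0)"
      using has_vector_derivative_continuous[OF \<gamma>(3)] \<gamma>(1) by (simp add: continuous_at)
    with \<gamma>(2) have in_MU: "\<forall>\<^sub>F t in at 0. \<gamma> t \<in> M \<inter> U"
      using topological_tendstoD[OF \<open>(\<gamma> \<longlongrightarrow> x) (at 0)\<close> U] by (simp add: eventually_conj_iff)
    define w where "w t = \<psi> (\<gamma> t)" for t
    have \<phi>_w: "\<forall>\<^sub>F t in at 0. \<phi> (w t) = \<gamma> t"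
      using in_MU by eventually_elim (use homeomorphism_apply2[OF hom] in \<open>auto simp: w_def\<close>)
    have w_lim: "(w \<longlongrightarrow> w0) (at 0)"
      unfolding w_def w0_def
      using continuous_on_tendsto_compose[OF homeomorphism_cont2[OF hom] \<open>(\<gamma> \<longlongrightarrow> x) (at 0)\<close> _ in_MU]
        U(2) \<open>x \<in> M\<close> by simp
    define s where "s t = (\<gamma> t - x) /\<^sub>R t" for t
    have s_lim: "(s \<longlongrightarrow> v) (at 0)"
    proof -
      have "((\<lambda>t. norm (\<gamma> t - x - t *\<^sub>R v) / norm t) \<longlongrightarrow> 0) (at 0)"
        using \<gamma>(3) \<gamma>(1) by (simp add: has_vector_derivative_def has_derivative_at)
      moreover have "\<forall>\<^sub>F t in at 0. norm (\<gamma> t - x - t *\<^sub>R v) / norm t = norm (s t - v)"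
      proof -
        have "norm (\<gamma> t - x - t *\<^sub>R v) / norm t = norm (s t - v)" if "t \<noteq> 0" for t
        proof -
          have "s t - v = (\<gamma> t - x - t *\<^sub>R v) /\<^sub>R t"
            using that by (simp add: s_def scaleR_diff_right)
          then show ?thesis by (simp add: divide_inverse_commute)
        qed
        then show ?thesis by (simp add: eventually_at_filter)
      qed
      ultimately have "((\<lambda>t. norm (s t - v)) \<longlongrightarrow> 0) (at 0)"
        by (rule Lim_transform_eventually)
      then show ?thesis by (simp add: tendsto_norm_zero_iff LIM_zero_iff)
    qed
    obtain b where b: "b > 0" "\<And>u. b * norm u \<le> norm (D u)"
      using linear_inj_bounded_below_pos[OF D(1,2)] by metis
    have "infdist v (range D) \<le> e" if "e > 0" for e
    proof -
      \<comment> \<open>The bound \<open>b / 2\<close> lets the linearisation error be absorbed into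
        \<open>b * norm (w t - w0)\<close>, giving the estimate with constant \<open>2 / b\<close>.
        The other bound makes the limit \<open>e' * (2 / b) * norm v\<close> at most
        \<open>e\<close>; adding 1 keeps the denominator positive when \<open>v = 0\<close>.\<close>
      define e' where "e' = min (b / 2) (e * b / (2 * (norm v + 1)))"
      have e': "e' > 0" "e' \<le> b / 2" "e' * (2 / b) * norm v \<le> e"
      proof -
        show "e' > 0" using b(1) \<open>e > 0\<close> by (simp add: e'_def add_pos_nonneg add_nonneg_pos)
        show "e' \<le> b / 2" unfolding e'_def by (rule min.cobounded1)
        have "e' * (2 / b) * norm v \<le> e * b / (2 * (norm v + 1)) * (2 / b) * norm v"
          using b(1) by (intro mult_right_mono) (auto simp: e'_def)
        also have "\<dots> = e * (norm v / (norm v + 1))"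
        proof -
          have "e * b / (2 * n) * (2 / b) * r = e * (r / n)" for n r
            using b(1) by simp
          then show ?thesis .
        qed
        also have "\<dots> \<le> e * 1"
          using \<open>e > 0\<close> by (intro mult_left_mono) (auto simp: divide_le_eq add_nonneg_pos)
        finally show "e' * (2 / b) * norm v \<le> e" by simp
      qed
      obtain d where d: "d > 0"
        "\<And>u. norm (u - w0) < d \<Longrightarrow> norm (\<phi> u - \<phi> w0 - D (u - w0)) \<le> e' * norm (u - w0)"
        using D(3) e'(1) unfolding has_derivative_at_alt by metis
      have "\<forall>\<^sub>F t in at 0. norm (w t - w0) < d"
        using tendstoD[OF w_lim d(1)] by (simp add: dist_norm)
      then have "\<forall>\<^sub>F t in at 0. infdist (s t) (range D) \<le> e' * (2 / b) * norm (s t)"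
        using \<phi>_w
      proof eventually_elim
        case (elim t)
        have close: "norm (\<gamma> t - x - D (w t - w0)) \<le> e' * norm (w t - w0)"
          using d(2)[OF elim(1)] by (simp add: elim(2) w0(2))
        have "b * norm (w t - w0) \<le> norm (D (w t - w0))" by (rule b(2))
        also have "\<dots> \<le> norm (\<gamma> t - x) + norm (\<gamma> t - x - D (w t - w0))"
          using norm_triangle_ineq4[of "\<gamma> t - x" "\<gamma> t - x - D (w t - w0)"] by simp
        also have "\<dots> \<le> norm (\<gamma> t - x) + b / 2 * norm (w t - w0)"
          using close mult_right_mono[OF e'(2), of "norm (w t - w0)"] by simp
        finally have "norm (w t - w0) \<le> 2 / b * norm (\<gamma> t - x)"
          using b(1) by (simp add: field_simps)
        then have "norm (\<gamma> t - x - D (w t - w0)) \<le> e' * (2 / b * norm (\<gamma> t - x))"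
          using e'(1) by (intro order_trans[OF close] mult_left_mono) simp_all
        then have le: "\<bar>inverse t\<bar> * norm (\<gamma> t - x - D (w t - w0)) \<le>
            \<bar>inverse t\<bar> * (e' * (2 / b * norm (\<gamma> t - x)))"
          by (intro mult_left_mono) auto
        have "infdist (s t) (range D) \<le> dist (s t) (D ((w t - w0) /\<^sub>R t))"
          by (intro infdist_le) auto
        also have "dist (s t) (D ((w t - w0) /\<^sub>R t)) =
            norm ((\<gamma> t - x - D (w t - w0)) /\<^sub>R t)"
          unfolding dist_norm linear_scale[OF D(1)] s_def by (simp add: scaleR_diff_right)
        also have "\<dots> \<le> e' * (2 / b) * norm (s t)"
          using le by (simp add: s_def mult_ac)
        finally show ?case .
      qed
      moreover have "((\<lambda>t. infdist (s t) (range D)) \<longlongrightarrow> infdist v (range D)) (at 0)"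
        "((\<lambda>t. e' * (2 / b) * norm (s t)) \<longlongrightarrow> e' * (2 / b) * norm v) (at 0)"
        by (rule tendsto_infdist[OF s_lim], rule tendsto_mult_left[OF tendsto_norm[OF s_lim]])
      ultimately have "infdist v (range D) \<le> e' * (2 / b) * norm v"
        by (intro tendsto_le[OF at_neq_bot])
      then show ?thesis using e'(3) by simp
    qed
    then have "infdist v (range D) = 0"
      by (intro antisym infdist_nonneg, rule field_le_epsilon) simp
    then show "v \<in> range D"
      using in_closed_iff_infdist_zero[OF closed_subspace[OF linear_subspace_image[OF D(1) subspace_UNIV]]]
      by simp
  qed
  ultimately show thesis using that D by blast
qed

text \<open>Along a curve in \<open>M\<close> with velocity \<open>v\<close>, the squared norm of
  \<open>F\<close> has a minimum at time 0, where its derivative is twice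
  \<open>F x \<bullet> B v\<close>.\<close>

lemma inner_tangent_eq_0_of_min:
  fixes F :: "'a::real_normed_vector \<Rightarrow> 'b::real_inner"
  assumes F: "(F has_derivative B) (at x within S)" and "M \<subseteq> S" "x \<in> M"
    and min: "\<And>y. y \<in> M \<Longrightarrow> F x \<bullet> F x \<le> F y \<bullet> F y" and "v \<in> tangent_space M x"
  shows "F x \<bullet> B v = 0"
proof -
  obtain \<gamma> where \<gamma>: "\<gamma> 0 = x" "\<forall>\<^sub>F t in at (0::real). \<gamma> t \<in> M" "(\<gamma> has_vector_derivative v) (at 0)"
    using \<open>v \<in> tangent_space M x\<close> unfolding tangent_space_def by auto
  obtain d where d: "d > 0" "\<And>t. t \<noteq> 0 \<Longrightarrow> dist t 0 < d \<Longrightarrow> \<gamma> t \<in> M"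
    using \<gamma>(2) unfolding eventually_at by auto
  have \<gamma>_M: "\<gamma> ` ball 0 d \<subseteq> M"
  proof (rule image_subsetI)
    show "\<gamma> t \<in> M" if "t \<in> ball 0 d" for t
      using d(2)[of t] that \<gamma>(1) \<open>x \<in> M\<close> by (cases "t = 0") (simp_all add: dist_commute)
  qed
  \<comment> \<open>\<open>F\<close> is differentiable only within \<open>S\<close>, so the chain
    rule needs a time interval on which \<open>\<gamma>\<close> stays in \<open>S\<close>. Such an
    open interval does not change the filter at 0.\<close>
  have 0: "at 0 within ball 0 d = at (0::real)"
    using d(1) by (intro at_within_open) auto
  have "(\<gamma> has_derivative (\<lambda>t. t *\<^sub>R v)) (at 0 within ball 0 d)"
    using \<gamma>(3) by (simp add: 0 has_vector_derivative_def)
  then have "((\<lambda>t. F (\<gamma> t)) has_derivative (\<lambda>t. B (t *\<^sub>R v))) (at 0 within ball 0 d)"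
    by (rule has_derivative_in_compose) (use F \<gamma>_M \<open>M \<subseteq> S\<close> \<gamma>(1) in \<open>auto intro: has_derivative_subset\<close>)
  then have "((\<lambda>t. F (\<gamma> t) \<bullet> F (\<gamma> t)) has_derivative
      (\<lambda>t. F x \<bullet> B (t *\<^sub>R v) + B (t *\<^sub>R v) \<bullet> F x)) (at 0)"
    unfolding 0 using \<gamma>(1) by (auto intro!: derivative_eq_intros)
  moreover have "\<forall>\<^sub>F t in at 0. F (\<gamma> 0) \<bullet> F (\<gamma> 0) \<le> F (\<gamma> t) \<bullet> F (\<gamma> t)"
    using \<gamma>(2) by eventually_elim (simp add: \<gamma>(1) min)
  ultimately have "(\<lambda>t. F x \<bullet> B (t *\<^sub>R v) + B (t *\<^sub>R v) \<bullet> F x) = (\<lambda>t. 0)"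
    by (rule has_derivative_local_min)
  from fun_cong[OF this, of 1] show ?thesis by (simp add: inner_commute)
qed

section \<open>The conditional density on the tangent plane\<close>

theorem theorem3p8:
  fixes F :: "elements \<Rightarrow> real ^ 'm"
    and AR K K' :: "range_pair set"
    and start best :: "range_pair \<Rightarrow> attributable"
    and M T :: "elements set"
    and xs :: elements
    and L :: "elements \<Rightarrow> real ^ 'm"
    and chi :: "elements \<Rightarrow> real"
  assumes "CARD('m) \<ge> 6"
    and "residual_map F"
    and "compact AR" and "AR \<subseteq> range_space" and "K \<subseteq> AR"
    and "K' = {r \<in> K. \<exists>l. dc_converges_to F r (start r) l}"
    and "\<And>r. r \<in> K' \<Longrightarrow> dc_converges_to F r (start r) (best r)"
    and "\<And>r. r \<in> K' \<Longrightarrow> \<forall>\<^sub>F a in nhds (best r). target F (best r, r) \<le> target F (a, r)"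
    and "M = manifold_of_variations K' best"
    and "C1_surface M"
    and "best_fitting_orbit F K' best xs"
    and "T = tangent_plane M xs"
    and "L = linearisation F xs"
    and "inj_on L T"
    and "chi = chi_value L (target_min F K' best)"
  shows "conditional_elements L T =
    density (plane_lborel T)
      (\<lambda>x. ennreal (exp (- (chi x)\<^sup>2 / 2) / (\<integral>y. exp (- (chi y)\<^sup>2 / 2) \<partial>plane_lborel T)))"
proof -
  have F: "(F has_derivative B) (at x within element_space)"
    if "x \<in> element_space" "B = design F x" for x B
    using that assms(2) by (auto simp: residual_map_def differentiable_on_def design_def
        frechet_derivative_works)
  \<comment> \<open>\<open>M\<close> contains all lifts of each best-fit attributable, while the
    minimum is taken over one lift per \<open>r\<close>. Periodicity in the right ascension bridges
    the two.\<close>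
  have target_turn: "target F (turn k (best r), r) = target F (best r, r)"
    and in_space: "(turn k (best r), r) \<in> element_space" if "r \<in> K'" for k r
  proof -
    have "(best r, r) \<in> element_space"
      using assms(4-7) that by (auto simp: element_space_def dc_converges_to_def)
    then have "F (turn k (best r), r) = F (best r, r)"
      using assms(2) unfolding residual_map_def by fastforce
    then show "target F (turn k (best r), r) = target F (best r, r)"
      by (simp add: target_def)
    show "(turn k (best r), r) \<in> element_space"
      using \<open>(best r, r) \<in> element_space\<close>
      by (auto simp: element_space_def attributable_space_def turn_def)
  qed
  have xs: "xs \<in> M" "target F xs = target_min F K' best"
    using assms(9,11) by (auto simp: best_fitting_orbit_def)
  have M_sub: "M \<subseteq> element_space"
    using in_space by (auto simp: assms(9) manifold_of_variations_def)
  have min: "F xs \<bullet> F xs \<le> F y \<bullet> F y" if "y \<in> M" for y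
  proof -
    from that obtain k r where y: "y = (turn k (best r), r)" "r \<in> K'"
      by (auto simp: assms(9) manifold_of_variations_def)
    have "target F xs \<le> target F (best r, r)"
      \<comment> \<open>The infimum is a genuine lower bound because the target function is bounded
        below by 0.\<close>
      unfolding xs(2) target_min_def
      by (rule cINF_lower[OF _ y(2)]) (auto simp: target_def intro!: bdd_belowI2[of _ 0])
    also have "\<dots> = target F y" by (simp add: y target_turn)
    finally show ?thesis by (simp add: target_def divide_le_cancel)
  qed

  define B where "B = design F xs"
  have B: "(F has_derivative B) (at xs within element_space)"
    using F[OF subsetD[OF M_sub xs(1)] B_def] .
  then have "linear B" by (rule has_derivative_linear)
  obtain D :: "real ^ 2 \<Rightarrow> elements" where D: "linear D" "inj D" "tangent_space M xs = range D"
    using tangent_space_C1_surface[OF assms(10) xs(1)] .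
  define S where "S = tangent_space M xs"
  have S: "subspace S" "dim S = 2"
    using D linear_subspace_image[OF D(1) subspace_UNIV] dim_image_eq[of D UNIV]
    by (auto simp: S_def)
  have T: "T = (+) xs ` S" by (simp add: assms(12) tangent_plane_def S_def)
  have L: "L x = (F xs - B xs) + B x" for x
    by (simp add: assms(13) linearisation_def B_def[symmetric] linear_diff[OF \<open>linear B\<close>])
  have orth: "F xs \<bullet> B v = 0" if "v \<in> S" for v
    using inner_tangent_eq_0_of_min[OF B M_sub xs(1) min] that by (simp add: S_def)
  \<comment> \<open>\<open>sqrt\<close> is odd in Isabelle, so the radicand must be seen to be nonnegative on \<open>T\<close>.\<close>
  have chi: "(chi x)\<^sup>2 = L x \<bullet> L x - F xs \<bullet> F xs" if "x \<in> T" for x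
  proof -
    from that obtain v where v: "v \<in> S" "x = xs + v" by (auto simp: T)
    have "L x = F xs + B v" by (simp add: L v linear_add[OF \<open>linear B\<close>])
    then have Lx: "L x \<bullet> L x - F xs \<bullet> F xs = B v \<bullet> B v"
      using orth[OF v(1)] by (simp add: inner_add_left inner_add_right inner_commute)
    have "chi x = sqrt (L x \<bullet> L x - F xs \<bullet> F xs)"
      by (simp add: assms(15) chi_value_def xs(2)[symmetric] target_def right_diff_distrib)
    then show ?thesis by (simp add: Lx)
  qed

  have "continuous_on UNIV L"
    unfolding L by (intro continuous_intros linear_continuous_on
        linear_conv_bounded_linear[THEN iffD1] \<open>linear B\<close>)
  then have [measurable]: "L \<in> borel_measurable borel"
    by (rule borel_measurable_continuous_onI)
  have [measurable]: "chi \<in> borel_measurable borel"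
    unfolding assms(15) chi_value_def[abs_def] target_def by measurable
  have [measurable]: "(gaussian_density :: real ^ 'm \<Rightarrow> real) \<in> borel_measurable borel"
    unfolding gaussian_density_def[abs_def] by measurable
  have meas: "borel_measurable (plane_lborel T) = borel_measurable borel"
    by (intro measurable_cong_sets) (auto simp: plane_lborel_def)

  \<comment> \<open>This is \<open>gaussian_density (F xs)\<close>, the constant factor left over
    once \<open>chi\<close> has been split off by Pythagoras.\<close>
  define C where "C = (2 * pi) powr (- real CARD('m) / 2) * exp (- (F xs \<bullet> F xs) / 2)"
  have "C > 0" by (simp add: C_def)
  have AE_T: "AE x in plane_lborel T. x \<in> T"
    unfolding T by (rule AE_plane_lborel[OF S])
  have p: "gaussian_density (L x) = C * exp (- (chi x)\<^sup>2 / 2)" if "x \<in> T" for x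
    unfolding chi[OF that] C_def gaussian_density_def
    by (simp add: exp_add[symmetric] diff_divide_distrib)
  have int: "(\<integral>y. gaussian_density (L y) \<partial>plane_lborel T) =
      C * (\<integral>y. exp (- (chi y)\<^sup>2 / 2) \<partial>plane_lborel T)"
  proof -
    have "(\<integral>y. gaussian_density (L y) \<partial>plane_lborel T) =
        (\<integral>y. C * exp (- (chi y)\<^sup>2 / 2) \<partial>plane_lborel T)"
      \<comment> \<open>The factorisation \<open>p\<close> rests on orthogonality and so is
        available only on \<open>T\<close>; almost everywhere equality is what can be used.\<close>
      by (rule integral_cong_AE) (use AE_T in \<open>auto simp: meas p\<close>)
    then show ?thesis by simp
  qed
  have "conditional_elements L T = density (plane_lborel T)
      (\<lambda>x. ennreal (gaussian_density (L x) / (\<integral>y. gaussian_density (L y) \<partial>plane_lborel T)))"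
    unfolding conditional_elements_def
    by (rule propagate_back_affine[OF \<open>linear B\<close> L S T \<open>inj_on L T\<close>]) measurable
  also have "\<dots> = density (plane_lborel T)
      (\<lambda>x. ennreal (exp (- (chi x)\<^sup>2 / 2) / (\<integral>y. exp (- (chi y)\<^sup>2 / 2) \<partial>plane_lborel T)))"
    by (rule density_cong) (use AE_T \<open>C > 0\<close> in \<open>auto simp: meas p int\<close>)
  finally show ?thesis .
qed

end
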